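(* Let $N_c\ge 2$ and $k\ge 1$ be integers, let $\Phi_1,\dots,\Phi_{(N_c-1)k}$ (fine-grid time-stepping operators) and $\Psi_1,\dots,\Psi_{N_c-1}$ (coarse-grid time-stepping operators) be $n\times n$ matrices, and write $\Phi_i^j:=\Phi_i\Phi_{i-1}\cdots\Phi_j$ for $i\ge j$. Assume that $\Phi_{ik}^{(i-1)k+1}-\Psi_i$ is invertible for every $i=1,\dots,N_c-1$. With $A_\Delta$, $B_\Delta$, $\widetilde{B}_\Delta$, $\widehat{B}_\Delta$, $\widetilde{D}$ as defined in the context, set $\widetilde{\mathcal{R}}_F:=I-A_\Delta B_\Delta^{-1}$ and $\widetilde{\mathcal{E}}_F:=I-B_\Delta^{-1}A_\Delta$. Then $$\|\widetilde{\mathcal{R}}_F\|=\sigma_{\max}\big(\widetilde{D}\widetilde{B}_\Delta^{-1}\big)=\frac{1}{\sigma_{\min}\big(\widetilde{B}_\Delta\widetilde{D}^{-1}\big)},\qquad \|\widetilde{\mathcal{E}}_F\|=\sigma_{\max}\big(\widehat{B}_\Delta^{-1}\widetilde{D}\big)=\frac{1}{\sigma_{\min}\big(\widetilde{D}^{-1}\widehat{B}_\Delta\big)}.$$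
   Context: $\|\cdot\|$ is the $\ell^2$ operator norm; $\sigma_{\max},\sigma_{\min}$ denote the largest and smallest singular values. $A_\Delta$ and $B_\Delta$ are $N_c\times N_c$ block matrices with $n\times n$ blocks, with block rows and columns indexed $0,\dots,N_c-1$. Both are block lower bidiagonal with identity blocks on the diagonal. For $i=1,\dots,N_c-1$, the subdiagonal block in position $(i,i-1)$ is $-\Phi_{ik}^{(i-1)k+1}$ for $A_\Delta$ and $-\Psi_i$ for $B_\Delta$. All other blocks are zero. $\widetilde{B}_\Delta$ is the principal submatrix of $B_\Delta$ obtained by deleting the last block row and block column (so its subdiagonal blocks are $-\Psi_1,\dots,-\Psi_{N_c-2}$). $\widehat{B}_\Delta$ is the principal submatrix of $B_\Delta$ obtained by deleting the first block row and block column (so its subdiagonal blocks are $-\Psi_2,\dots,-\Psi_{N_c-1}$). $\widetilde{D}$ is the $(N_c-1)\times(N_c-1)$ block diagonal matrix with diagonal blocks $\Phi_{ik}^{(i-1)k+1}-\Psi_i$, $i=1,\dots,N_c-1$. *)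

theory Defs
  imports
    "Jordan_Normal_Form.Schur_Decomposition"
    "Jordan_Normal_Form.Gauss_Jordan_Elimination"
    "Jordan_Normal_Form.DL_Submatrix"
    "HOL-Analysis.L2_Norm"
begin

definition l2_norm_vec :: "complex vec \<Rightarrow> real" where
  "l2_norm_vec v = L2_set (\<lambda>i. cmod (v $ i)) {..<dim_vec v}"

definition l2_op_norm :: "complex mat \<Rightarrow> real" where
  "l2_op_norm A = Sup {l2_norm_vec (A *\<^sub>v v) / l2_norm_vec v | v.
     v \<in> carrier_vec (dim_col A) \<and> v \<noteq> 0\<^sub>v (dim_col A)}"

text \<open>The nonnegative square roots of the eigenvalues of the conjugate transpose of \<open>A\<close>
  times \<open>A\<close>; all matrices below are square, so no further zeros have to be discarded.\<close>

definition singular_values :: "complex mat \<Rightarrow> real set" where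
  "singular_values A =
     {s. 0 \<le> s \<and> eigenvalue (mat_adjoint A * A) (complex_of_real (s\<^sup>2))}"

definition sigma_max :: "complex mat \<Rightarrow> real" where
  "sigma_max A = Max (singular_values A)"

definition sigma_min :: "complex mat \<Rightarrow> real" where
  "sigma_min A = Min (singular_values A)"

text \<open>Junk value if \<open>A\<close> is singular; only used for invertible matrices.\<close>

definition minv :: "complex mat \<Rightarrow> complex mat" where
  "minv A = the (mat_inverse A)"

text \<open>\<open>\<Phi> i * \<Phi> (i - 1) * \<dots> * \<Phi> j\<close> for \<open>i \<ge> j\<close>, where the factors are \<open>n \<times> n\<close>.\<close>

definition step_prod :: "nat \<Rightarrow> (nat \<Rightarrow> complex mat) \<Rightarrow> nat \<Rightarrow> nat \<Rightarrow> complex mat" where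
  "step_prod n \<Phi> i j = foldr (\<lambda>l P. \<Phi> l * P) (rev [j..<Suc i]) (1\<^sub>m n)"

text \<open>The \<open>N \<times> N\<close> block matrix with \<open>n \<times> n\<close> blocks \<open>F i j\<close>, where \<open>i, j \<in> {0..<N}\<close>.\<close>

definition block_mat :: "nat \<Rightarrow> nat \<Rightarrow> (nat \<Rightarrow> nat \<Rightarrow> complex mat) \<Rightarrow> complex mat" where
  "block_mat N n F =
     mat (N * n) (N * n) (\<lambda>(r, c). F (r div n) (c div n) $$ (r mod n, c mod n))"

definition block_lower_bidiag :: "nat \<Rightarrow> nat \<Rightarrow> (nat \<Rightarrow> complex mat) \<Rightarrow> complex mat" where
  "block_lower_bidiag N n L = block_mat N n
     (\<lambda>i j. if i = j then 1\<^sub>m n else if i = j + 1 then - L i else 0\<^sub>m n n)"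

definition A_Delta :: "nat \<Rightarrow> nat \<Rightarrow> nat \<Rightarrow> (nat \<Rightarrow> complex mat) \<Rightarrow> complex mat" where
  "A_Delta N n k \<Phi> = block_lower_bidiag N n (\<lambda>i. step_prod n \<Phi> (i * k) ((i - 1) * k + 1))"

definition B_Delta :: "nat \<Rightarrow> nat \<Rightarrow> (nat \<Rightarrow> complex mat) \<Rightarrow> complex mat" where
  "B_Delta N n \<Psi> = block_lower_bidiag N n \<Psi>"

definition B_tilde :: "nat \<Rightarrow> nat \<Rightarrow> (nat \<Rightarrow> complex mat) \<Rightarrow> complex mat" where
  "B_tilde N n \<Psi> = submatrix (B_Delta N n \<Psi>) {0..<(N - 1) * n} {0..<(N - 1) * n}"

definition B_hat :: "nat \<Rightarrow> nat \<Rightarrow> (nat \<Rightarrow> complex mat) \<Rightarrow> complex mat" where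
  "B_hat N n \<Psi> = submatrix (B_Delta N n \<Psi>) {n..<N * n} {n..<N * n}"

definition D_tilde ::
  "nat \<Rightarrow> nat \<Rightarrow> nat \<Rightarrow> (nat \<Rightarrow> complex mat) \<Rightarrow> (nat \<Rightarrow> complex mat) \<Rightarrow> complex mat" where
  "D_tilde N n k \<Phi> \<Psi> = diag_block_mat
     (map (\<lambda>i. step_prod n \<Phi> (i * k) ((i - 1) * k + 1) - \<Psi> i) [1..<N])"

definition R_F ::
  "nat \<Rightarrow> nat \<Rightarrow> nat \<Rightarrow> (nat \<Rightarrow> complex mat) \<Rightarrow> (nat \<Rightarrow> complex mat) \<Rightarrow> complex mat" where
  "R_F N n k \<Phi> \<Psi> = 1\<^sub>m (N * n) - A_Delta N n k \<Phi> * minv (B_Delta N n \<Psi>)"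

definition E_F ::
  "nat \<Rightarrow> nat \<Rightarrow> nat \<Rightarrow> (nat \<Rightarrow> complex mat) \<Rightarrow> (nat \<Rightarrow> complex mat) \<Rightarrow> complex mat" where
  "E_F N n k \<Phi> \<Psi> = 1\<^sub>m (N * n) - minv (B_Delta N n \<Psi>) * A_Delta N n k \<Phi>"

end

theory Submission
  imports Defs "Jordan_Normal_Form.Spectral_Radius"
begin

text \<open>The difference \<open>B - A\<close> (indices \<open>\<Delta>\<close> dropped) has \<open>D_tilde\<close> as its
  lower left block and zeros elsewhere. Since \<open>B\<close> is block lower triangular, \<open>(B - A) * minv B\<close>
  and \<open>minv B * (B - A)\<close> have the same shape, and their lower left blocks only see the leading,
  respectively trailing, diagonal block of \<open>minv B\<close>, that is the inverse of the corresponding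
  principal submatrix of \<open>B\<close>. Zero padding does not change the operator norm, and the singular
  values of an inverse are the reciprocals.\<close>

section \<open>The Euclidean norm and the adjoint\<close>

lemma l2_norm_vec_nonneg: "0 \<le> l2_norm_vec v"
  unfolding l2_norm_vec_def by simp

lemma l2_norm_vec_square: "(l2_norm_vec v)\<^sup>2 = (\<Sum>i<dim_vec v. (cmod (v $ i))\<^sup>2)"
  unfolding l2_norm_vec_def L2_set_def by (simp add: sum_nonneg)

lemma l2_norm_vec_eq_0_iff: "l2_norm_vec v = 0 \<longleftrightarrow> v = 0\<^sub>v (dim_vec v)"
proof
  assume "l2_norm_vec v = 0"
  then show "v = 0\<^sub>v (dim_vec v)"
    unfolding l2_norm_vec_def by (intro eq_vecI) (auto simp: L2_set_eq_0_iff)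
next
  assume "v = 0\<^sub>v (dim_vec v)"
  then have "v $ i = 0" if "i < dim_vec v" for i
    using that by (metis index_zero_vec(1))
  then show "l2_norm_vec v = 0"
    unfolding l2_norm_vec_def by (auto simp: L2_set_eq_0_iff)
qed

lemma l2_norm_vec_pos: "v \<noteq> 0\<^sub>v n \<Longrightarrow> v \<in> carrier_vec n \<Longrightarrow> 0 < l2_norm_vec v"
  using l2_norm_vec_eq_0_iff[of v] l2_norm_vec_nonneg[of v] by auto

lemma l2_norm_vec_append_square:
  "(l2_norm_vec (v @\<^sub>v w))\<^sup>2 = (l2_norm_vec v)\<^sup>2 + (l2_norm_vec w)\<^sup>2"
proof -
  let ?f = "\<lambda>i. (cmod ((v @\<^sub>v w) $ i))\<^sup>2"
  have "(\<Sum>i<dim_vec v + dim_vec w. ?f i)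
      = sum ?f {..<dim_vec v} + sum ?f {dim_vec v..<dim_vec v + dim_vec w}"
    unfolding lessThan_atLeast0 by (rule sum.atLeastLessThan_concat[symmetric]) auto
  also have "sum ?f {dim_vec v..<dim_vec v + dim_vec w} = (\<Sum>i<dim_vec w. ?f (i + dim_vec v))"
    using sum.shift_bounds_nat_ivl[of ?f 0 "dim_vec v" "dim_vec w"]
    by (simp add: lessThan_atLeast0 add.commute)
  finally show ?thesis
    unfolding l2_norm_vec_square by simp
qed

lemma cscalar_prod_self: "v \<bullet>c v = complex_of_real ((l2_norm_vec v)\<^sup>2)"
  unfolding l2_norm_vec_square scalar_prod_def
  by (auto simp: lessThan_atLeast0 complex_norm_square[symmetric] intro!: sum.cong)

text \<open>Since \<open>t\<close> is real, the two conjugate cross terms combine into a single real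
  part. This serves to expand the norms of \<open>v - t G v\<close> and of its image under
  \<open>A\<close> in the perturbation argument below.\<close>

lemma l2_norm_vec_diff_square:
  assumes v: "v \<in> carrier_vec n" and w: "w \<in> carrier_vec n"
  shows "(l2_norm_vec (v - complex_of_real t \<cdot>\<^sub>v w))\<^sup>2
    = (l2_norm_vec v)\<^sup>2 - 2 * t * Re (v \<bullet>c w) + t\<^sup>2 * (l2_norm_vec w)\<^sup>2"
proof -
  have "(cmod (a - of_real t * b))\<^sup>2 = (cmod a)\<^sup>2 - 2 * t * Re (a * cnj b) + t\<^sup>2 * (cmod b)\<^sup>2" for a b
    unfolding cmod_power2 by (simp add: power2_eq_square algebra_simps)
  then show ?thesis
    using v w unfolding l2_norm_vec_square scalar_prod_def
    by (simp add: lessThan_atLeast0 sum.distrib sum_subtractf sum_distrib_left distrib_left)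
qed

lemma mat_adjoint_dim [simp]:
  "dim_row (mat_adjoint A) = dim_col A" "dim_col (mat_adjoint A) = dim_row A"
  unfolding mat_adjoint_def by auto

lemma mat_adjoint_carrier: "A \<in> carrier_mat n m \<Longrightarrow> mat_adjoint A \<in> carrier_mat m n"
  by (intro carrier_matI) auto

lemma mat_adjoint_index:
  "i < dim_col A \<Longrightarrow> j < dim_row A \<Longrightarrow> mat_adjoint A $$ (i, j) = conjugate (A $$ (j, i))"
  unfolding mat_adjoint_def by (simp add: mat_of_rows_index)

lemma mat_adjoint_mult:
  fixes A B :: "complex mat"
  assumes "A \<in> carrier_mat n m" "B \<in> carrier_mat m l"
  shows "mat_adjoint (A * B) = mat_adjoint B * mat_adjoint A"
  using assms by (intro eq_matI)
    (auto simp: mat_adjoint_index scalar_prod_def cnj_sum mult.commute intro!: sum.cong)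

lemma mat_adjoint_one: "mat_adjoint (1\<^sub>m n :: complex mat) = 1\<^sub>m n"
  by (intro eq_matI) (auto simp: mat_adjoint_index)

lemma cscalar_prod_mat_adjoint:
  fixes A :: "complex mat"
  assumes A: "A \<in> carrier_mat m n" and v: "v \<in> carrier_vec n" and w: "w \<in> carrier_vec m"
  shows "(mat_adjoint A *\<^sub>v w) \<bullet>c v = w \<bullet>c (A *\<^sub>v v)"
proof -
  have "(mat_adjoint A *\<^sub>v w) \<bullet>c v = (\<Sum>i<n. \<Sum>j<m. cnj (A $$ (j, i)) * w $ j * cnj (v $ i))"
    using assms by (auto simp: scalar_prod_def lessThan_atLeast0 mat_adjoint_index sum_distrib_right
        intro!: sum.cong)
  also have "\<dots> = (\<Sum>j<m. \<Sum>i<n. cnj (A $$ (j, i)) * w $ j * cnj (v $ i))"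
    by (rule sum.swap)
  also have "\<dots> = w \<bullet>c (A *\<^sub>v v)"
    using assms by (auto simp: scalar_prod_def lessThan_atLeast0 cnj_sum sum_distrib_left mult_ac
        intro!: sum.cong)
  finally show ?thesis .
qed

text \<open>Cauchy-Schwarz applied to each row. The bound is crude, but it makes the supremum in
  \<open>l2_op_norm\<close> one of a bounded set, and it also controls the left inverse
  \<open>K\<close> of \<open>G\<close> below, where one divides by \<open>c\<close>.\<close>

lemma l2_norm_mult_mat_vec_bounded:
  fixes A :: "complex mat"
  shows "\<exists>c>0. \<forall>v \<in> carrier_vec (dim_col A). l2_norm_vec (A *\<^sub>v v) \<le> c * l2_norm_vec v"
proof -
  define c where "c = (\<Sum>i<dim_row A. l2_norm_vec (row A i))"
  \<comment> \<open>The added 1 keeps the constant positive even when all rows of \<open>A\<close>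
    vanish.\<close>
  have "l2_norm_vec (A *\<^sub>v v) \<le> (c + 1) * l2_norm_vec v" if v: "v \<in> carrier_vec (dim_col A)" for v
  proof -
    have "l2_norm_vec (A *\<^sub>v v) \<le> (\<Sum>i<dim_row A. cmod ((A *\<^sub>v v) $ i))"
      unfolding l2_norm_vec_def using L2_set_le_sum[of "{..<dim_row A}" "\<lambda>i. cmod ((A *\<^sub>v v) $ i)"] by simp
    also have "\<dots> \<le> (\<Sum>i<dim_row A. l2_norm_vec (row A i) * l2_norm_vec v)"
    proof (rule sum_mono)
      fix i assume "i \<in> {..<dim_row A}"
      then have "cmod ((A *\<^sub>v v) $ i) = cmod (\<Sum>j<dim_col A. A $$ (i, j) * v $ j)"
        using v by (auto simp: scalar_prod_def lessThan_atLeast0 intro!: arg_cong[of _ _ cmod] sum.cong)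
      also have "\<dots> \<le> (\<Sum>j<dim_col A. \<bar>cmod (A $$ (i, j))\<bar> * \<bar>cmod (v $ j)\<bar>)"
        by (rule order_trans[OF norm_sum]) (simp add: norm_mult)
      also have "\<dots> \<le> L2_set (\<lambda>j. cmod (A $$ (i, j))) {..<dim_col A} * L2_set (\<lambda>j. cmod (v $ j)) {..<dim_col A}"
        by (rule L2_set_mult_ineq)
      also have "\<dots> = l2_norm_vec (row A i) * l2_norm_vec v"
        using v \<open>i \<in> _\<close> unfolding l2_norm_vec_def by (auto intro!: arg_cong2[of _ _ _ _ "(*)"] L2_set_cong)
      finally show "cmod ((A *\<^sub>v v) $ i) \<le> l2_norm_vec (row A i) * l2_norm_vec v" .
    qed
    also have "\<dots> \<le> (c + 1) * l2_norm_vec v"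
      using l2_norm_vec_nonneg[of v] by (simp add: c_def sum_distrib_right distrib_right)
    finally show ?thesis .
  qed
  moreover have "c + 1 > 0" using l2_norm_vec_nonneg by (simp add: c_def add_nonneg_pos sum_nonneg)
  ultimately show ?thesis by blast
qed

section \<open>The operator norm is the largest singular value\<close>

lemma l2_op_norm_eqI:
  assumes "v \<in> carrier_vec (dim_col A)" "v \<noteq> 0\<^sub>v (dim_col A)" "l2_norm_vec (A *\<^sub>v v) = s * l2_norm_vec v"
    and le: "\<And>w. w \<in> carrier_vec (dim_col A) \<Longrightarrow> l2_norm_vec (A *\<^sub>v w) \<le> s * l2_norm_vec w"
  shows "l2_op_norm A = s"
  unfolding l2_op_norm_def
proof (rule cSup_eq_maximum)
  show "s \<in> {l2_norm_vec (A *\<^sub>v v) / l2_norm_vec v |v. v \<in> carrier_vec (dim_col A) \<and> v \<noteq> 0\<^sub>v (dim_col A)}"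
    using assms(1-3) l2_norm_vec_pos[OF assms(2,1)] by (auto intro!: exI[of _ v])
  show "x \<le> s" if "x \<in> {l2_norm_vec (A *\<^sub>v v) / l2_norm_vec v |v.
      v \<in> carrier_vec (dim_col A) \<and> v \<noteq> 0\<^sub>v (dim_col A)}" for x
    using that le l2_norm_vec_pos by (auto simp: divide_le_eq)
qed

lemma l2_norm_mult_le_op_norm:
  assumes v: "v \<in> carrier_vec (dim_col A)"
  shows "l2_norm_vec (A *\<^sub>v v) \<le> l2_op_norm A * l2_norm_vec v"
proof (cases "v = 0\<^sub>v (dim_col A)")
  case True
  then have "A *\<^sub>v v = 0\<^sub>v (dim_row A)" by (intro eq_vecI) auto
  then show ?thesis using True l2_norm_vec_eq_0_iff[of v] l2_norm_vec_eq_0_iff[of "A *\<^sub>v v"] by simp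
next
  case False
  obtain c where c: "\<forall>v \<in> carrier_vec (dim_col A). l2_norm_vec (A *\<^sub>v v) \<le> c * l2_norm_vec v"
    using l2_norm_mult_mat_vec_bounded by blast
  have pos: "0 < l2_norm_vec v" using l2_norm_vec_pos[OF False v] .
  have "l2_norm_vec (A *\<^sub>v v) / l2_norm_vec v \<le> l2_op_norm A"
    unfolding l2_op_norm_def
  proof (rule cSup_upper)
    show "bdd_above {l2_norm_vec (A *\<^sub>v v) / l2_norm_vec v |v.
        v \<in> carrier_vec (dim_col A) \<and> v \<noteq> 0\<^sub>v (dim_col A)}"
      using c l2_norm_vec_pos by (auto intro!: bdd_aboveI[of _ c] simp: divide_le_eq)
  qed (use v False in blast)
  then show ?thesis using pos by (simp add: divide_le_eq)
qed

text \<open>The supremum \<open>s\<close> need not be known to be attained: if \<open>G = s\<^sup>2 - A\<^sup>* A\<close>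
  were invertible, then its nonnegative quadratic form, evaluated at \<open>v - t G v\<close> for a small
  \<open>t > 0\<close>, would give \<open>s\<^sup>2 |v|\<^sup>2 - |A v|\<^sup>2 \<ge> t |G v|\<^sup>2 \<ge> d |v|\<^sup>2\<close> with \<open>d > 0\<close>,
  so that \<open>s\<close> would not be the least upper bound.\<close>

lemma l2_op_norm_square_eigenvalue:
  assumes A: "A \<in> carrier_mat n n" and n: "n > 0"
  shows "0 \<le> l2_op_norm A" "eigenvalue (mat_adjoint A * A) (complex_of_real ((l2_op_norm A)\<^sup>2))"
proof -
  define s where "s = l2_op_norm A"
  define nz where "nz = {v :: complex vec. v \<in> carrier_vec n \<and> v \<noteq> 0\<^sub>v n}"
  \<comment> \<open>Positive dimension supplies a nonzero vector, so the set of quotients defining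
    \<open>l2_op_norm\<close> is nonempty.\<close>
  have "unit_vec n 0 \<in> nz" using n unfolding nz_def by auto
  then obtain u where u: "u \<in> nz" by blast
  have pos: "0 < l2_norm_vec v" if "v \<in> nz" for v
    using that l2_norm_vec_pos unfolding nz_def by auto
  have le: "l2_norm_vec (A *\<^sub>v v) \<le> s * l2_norm_vec v" if "v \<in> carrier_vec n" for v
    using l2_norm_mult_le_op_norm[of v A] that A unfolding s_def by auto
  have "0 \<le> s * l2_norm_vec u"
    using le[of u] l2_norm_vec_nonneg[of "A *\<^sub>v u"] u unfolding nz_def by auto
  then have s0: "0 \<le> s" using pos[OF u] by (simp add: zero_le_mult_iff)
  have sup_le: "s \<le> b" if "\<And>v. v \<in> nz \<Longrightarrow> l2_norm_vec (A *\<^sub>v v) \<le> b * l2_norm_vec v" for b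
    unfolding s_def l2_op_norm_def
  proof (rule cSup_least)
    show "{l2_norm_vec (A *\<^sub>v v) / l2_norm_vec v |v.
        v \<in> carrier_vec (dim_col A) \<and> v \<noteq> 0\<^sub>v (dim_col A)} \<noteq> {}"
      using u A unfolding nz_def by auto
    fix r assume "r \<in> {l2_norm_vec (A *\<^sub>v v) / l2_norm_vec v |v.
        v \<in> carrier_vec (dim_col A) \<and> v \<noteq> 0\<^sub>v (dim_col A)}"
    then obtain v where "v \<in> nz" "r = l2_norm_vec (A *\<^sub>v v) / l2_norm_vec v"
      using A unfolding nz_def by auto
    then show "r \<le> b" using that[of v] pos[of v] by (simp add: divide_le_eq)
  qed
  define H where "H = mat_adjoint A * A"
  define G where "G = complex_of_real (s\<^sup>2) \<cdot>\<^sub>m 1\<^sub>m n - H"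
  have H: "H \<in> carrier_mat n n"
    unfolding H_def by (rule mult_carrier_mat[OF mat_adjoint_carrier[OF A] A])
  have G: "G \<in> carrier_mat n n"
    unfolding G_def by (rule minus_carrier_mat[OF H])
  have Gv: "G *\<^sub>v v = complex_of_real (s\<^sup>2) \<cdot>\<^sub>v v - H *\<^sub>v v" if v: "v \<in> carrier_vec n" for v
  proof -
    have "(complex_of_real (s\<^sup>2) \<cdot>\<^sub>m 1\<^sub>m n) *\<^sub>v v = complex_of_real (s\<^sup>2) \<cdot>\<^sub>v v"
      using v by (intro eq_vecI) auto
    then show ?thesis
      using minus_mult_distrib_mat_vec[OF _ H v] unfolding G_def by simp
  qed
  \<comment> \<open>A nonzero kernel vector of \<open>G\<close> is an eigenvector of
    \<open>H\<close> for \<open>s\<^sup>2\<close>, so the claim reduces to singularity of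
    \<open>G\<close>.\<close>
  have "det G = 0"
  proof (rule ccontr)
    assume "det G \<noteq> 0"
    from det_non_zero_imp_unit[OF G this, unfolded Units_def ring_mat_def]
    obtain K where K: "K \<in> carrier_mat n n" "K * G = 1\<^sub>m n" by auto
    obtain c where c: "c > 0" "\<forall>v\<in>carrier_vec n. l2_norm_vec (K *\<^sub>v v) \<le> c * l2_norm_vec v"
      using l2_norm_mult_mat_vec_bounded[of K] K by auto
    \<comment> \<open>Chosen so that \<open>t * s\<^sup>2\<close> is at most 1: the second-order
      term \<open>t\<^sup>2 * s\<^sup>2 * |w|^2\<close> then costs at most half of the first-order
      gain \<open>2 * t * |w|^2\<close>. The 1 in the denominator covers
      \<open>s = 0\<close>.\<close>
    define t where "t = 1 / (s\<^sup>2 + 1)"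
    have t: "t > 0" "t * s\<^sup>2 \<le> 1" unfolding t_def by (auto simp: field_simps add_pos_nonneg add_nonneg_pos)
    \<comment> \<open>From \<open>v = K w\<close> follows \<open>|v| \<le> c * |w|\<close>, so this
      \<open>d\<close> turns the gain \<open>t * |w|^2\<close> into at least
      \<open>d * |v|^2\<close>.\<close>
    define d where "d = t / c\<^sup>2"
    have d: "d > 0" using t c unfolding d_def by auto
    have key: "(l2_norm_vec (A *\<^sub>v v))\<^sup>2 \<le> (s\<^sup>2 - d) * (l2_norm_vec v)\<^sup>2" if v: "v \<in> carrier_vec n" for v
    proof -
      define w where "w = G *\<^sub>v v"
      define x where "x = v - complex_of_real t \<cdot>\<^sub>v w"
      have w: "w \<in> carrier_vec n" and x: "x \<in> carrier_vec n" using G v unfolding w_def x_def by auto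
      have Av: "A *\<^sub>v v \<in> carrier_vec n" and Aw: "A *\<^sub>v w \<in> carrier_vec n" using A v w by auto
      have "(H *\<^sub>v v) \<bullet>c w = (A *\<^sub>v v) \<bullet>c (A *\<^sub>v w)"
        using cscalar_prod_mat_adjoint[OF A w Av] mat_adjoint_carrier[OF A] A v
        unfolding H_def by (simp add: assoc_mult_mat_vec[of _ n n _ n])
      moreover have "w \<bullet>c w = complex_of_real (s\<^sup>2) * (v \<bullet>c w) - ((H *\<^sub>v v) \<bullet>c w)"
        using v w H unfolding w_def Gv[OF v]
        by (subst minus_scalar_prod_distrib[of _ n]) (auto)
      ultimately have "complex_of_real ((l2_norm_vec w)\<^sup>2)
          = complex_of_real (s\<^sup>2) * (v \<bullet>c w) - ((A *\<^sub>v v) \<bullet>c (A *\<^sub>v w))"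
        unfolding cscalar_prod_self by simp
      \<comment> \<open>With this identity the cross terms of
        \<open>s\<^sup>2 * |x|^2 - |A x|^2\<close>, expanded by \<open>ex\<close> and
        \<open>ex2\<close>, collapse to \<open>- 2 * t * |w|^2\<close>.\<close>
      from arg_cong[OF this, of Re]
      have ip: "(l2_norm_vec w)\<^sup>2 = s\<^sup>2 * Re (v \<bullet>c w) - Re ((A *\<^sub>v v) \<bullet>c (A *\<^sub>v w))"
        by (simp del: of_real_power)
      have "A *\<^sub>v x = A *\<^sub>v v - complex_of_real t \<cdot>\<^sub>v (A *\<^sub>v w)"
        using A v w unfolding x_def by (simp add: mult_minus_distrib_mat_vec[of _ n n] mult_mat_vec[of _ n n])
      then have ex: "(l2_norm_vec (A *\<^sub>v x))\<^sup>2
          = (l2_norm_vec (A *\<^sub>v v))\<^sup>2 - 2 * t * Re ((A *\<^sub>v v) \<bullet>c (A *\<^sub>v w)) + t\<^sup>2 * (l2_norm_vec (A *\<^sub>v w))\<^sup>2"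
        using l2_norm_vec_diff_square[OF Av Aw, of t] by simp
      have ex2: "(l2_norm_vec x)\<^sup>2 = (l2_norm_vec v)\<^sup>2 - 2 * t * Re (v \<bullet>c w) + t\<^sup>2 * (l2_norm_vec w)\<^sup>2"
        unfolding x_def by (rule l2_norm_vec_diff_square[OF v w])
      have "(l2_norm_vec (A *\<^sub>v x))\<^sup>2 \<le> s\<^sup>2 * (l2_norm_vec x)\<^sup>2"
        using power_mono[OF le[OF x] l2_norm_vec_nonneg, of 2] by (simp add: power_mult_distrib)
      moreover have "s\<^sup>2 * (l2_norm_vec x)\<^sup>2 - (l2_norm_vec (A *\<^sub>v x))\<^sup>2
          = s\<^sup>2 * (l2_norm_vec v)\<^sup>2 - (l2_norm_vec (A *\<^sub>v v))\<^sup>2 - 2 * t * (l2_norm_vec w)\<^sup>2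
            + t\<^sup>2 * s\<^sup>2 * (l2_norm_vec w)\<^sup>2 - t\<^sup>2 * (l2_norm_vec (A *\<^sub>v w))\<^sup>2"
        unfolding ex ex2 ip by (simp add: algebra_simps)
      moreover have "t\<^sup>2 * s\<^sup>2 * (l2_norm_vec w)\<^sup>2 \<le> t * (l2_norm_vec w)\<^sup>2"
        using mult_left_mono[OF t(2), of t] t(1)
        by (intro mult_right_mono) (auto simp: power2_eq_square mult_ac)
      moreover have "0 \<le> t\<^sup>2 * (l2_norm_vec (A *\<^sub>v w))\<^sup>2" by simp
      ultimately have "(l2_norm_vec (A *\<^sub>v v))\<^sup>2 \<le> s\<^sup>2 * (l2_norm_vec v)\<^sup>2 - t * (l2_norm_vec w)\<^sup>2"
        by linarith
      moreover have "d * (l2_norm_vec v)\<^sup>2 \<le> t * (l2_norm_vec w)\<^sup>2"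
      proof -
        have "K *\<^sub>v w = v"
          using K G v unfolding w_def by (simp flip: assoc_mult_mat_vec)
        with c w have "l2_norm_vec v \<le> c * l2_norm_vec w" by force
        from power_mono[OF this l2_norm_vec_nonneg, of 2] have "(l2_norm_vec v)\<^sup>2 \<le> c\<^sup>2 * (l2_norm_vec w)\<^sup>2"
          by (simp add: power_mult_distrib)
        from mult_left_mono[OF this, of d] d c show ?thesis
          unfolding d_def by simp
      qed
      ultimately show ?thesis by (simp add: algebra_simps)
    qed
    \<comment> \<open>Evaluating \<open>key\<close> at the nonzero vector \<open>u\<close> shows
      that the square root below is taken of a nonnegative number.\<close>
    have "0 \<le> (s\<^sup>2 - d) * (l2_norm_vec u)\<^sup>2"
      using key[of u] u unfolding nz_def by (auto intro: order_trans[OF zero_le_power2])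
    then have sd: "0 \<le> s\<^sup>2 - d" using pos[OF u] by (simp add: zero_le_mult_iff)
    have "s \<le> sqrt (s\<^sup>2 - d)"
    proof (rule sup_le)
      fix v assume "v \<in> nz"
      then have "(l2_norm_vec (A *\<^sub>v v))\<^sup>2 \<le> (sqrt (s\<^sup>2 - d) * l2_norm_vec v)\<^sup>2"
        using key[of v] sd unfolding nz_def by (simp add: power_mult_distrib)
      then show "l2_norm_vec (A *\<^sub>v v) \<le> sqrt (s\<^sup>2 - d) * l2_norm_vec v"
        by (rule power2_le_imp_le) (use sd l2_norm_vec_nonneg in auto)
    qed
    from power_mono[OF this s0, of 2] sd d show False by simp
  qed
  then obtain v where v: "v \<in> carrier_vec n" "v \<noteq> 0\<^sub>v n" "G *\<^sub>v v = 0\<^sub>v n"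
    using det_0_iff_vec_prod_zero_field[OF G] by blast
  have "H *\<^sub>v v = complex_of_real (s\<^sup>2) \<cdot>\<^sub>v v"
  proof (rule eq_vecI)
    fix i assume "i < dim_vec (complex_of_real (s\<^sup>2) \<cdot>\<^sub>v v)"
    then show "(H *\<^sub>v v) $ i = (complex_of_real (s\<^sup>2) \<cdot>\<^sub>v v) $ i"
      using arg_cong[OF v(3)[unfolded Gv[OF v(1)]], of "\<lambda>z. z $ i"] v(1) H by simp
  qed (use H v in auto)
  then have "eigenvector H v (complex_of_real (s\<^sup>2))"
    using v H unfolding eigenvector_def by auto
  then show "eigenvalue (mat_adjoint A * A) (complex_of_real ((l2_op_norm A)\<^sup>2))"
    unfolding eigenvalue_def H_def s_def by blast
  show "0 \<le> l2_op_norm A" using s0 unfolding s_def .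
qed

text \<open>The spectrum is finite and squaring is injective on the nonnegative reals. Finiteness is
  what gives \<open>Max\<close> and \<open>Min\<close> in \<open>sigma_max\<close> and
  \<open>sigma_min\<close> their meaning.\<close>

lemma finite_singular_values:
  assumes A: "A \<in> carrier_mat m n"
  shows "finite (singular_values A)"
proof -
  have "finite (Collect (eigenvalue (mat_adjoint A * A)))"
    using card_finite_spectrum(1)[of "mat_adjoint A * A" n] mat_adjoint_carrier[OF A] A
    unfolding spectrum_def by auto
  then have "finite ((\<lambda>s. complex_of_real (s\<^sup>2)) -` Collect (eigenvalue (mat_adjoint A * A)) \<inter> {0..})"
    by (rule finite_vimage_IntI) (auto simp: inj_on_def power2_eq_iff_nonneg simp del: of_real_power)
  then show ?thesis
    by (rule finite_subset[rotated]) (auto simp: singular_values_def)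
qed

text \<open>The norm identity comes from moving the adjoint across the inner product:
  \<open>|A v|^2\<close> equals the product of \<open>A\<^sup>* A v\<close> with \<open>v\<close>,
  which is \<open>s\<^sup>2 * |v|^2\<close>.\<close>

lemma singular_vector:
  assumes A: "A \<in> carrier_mat m n" and s: "s \<in> singular_values A"
  obtains v where "v \<in> carrier_vec n" "v \<noteq> 0\<^sub>v n"
    "mat_adjoint A *\<^sub>v (A *\<^sub>v v) = complex_of_real (s\<^sup>2) \<cdot>\<^sub>v v"
    "l2_norm_vec (A *\<^sub>v v) = s * l2_norm_vec v"
proof -
  from s obtain v where s0: "0 \<le> s" and v: "v \<in> carrier_vec n" "v \<noteq> 0\<^sub>v n"
    and ev: "(mat_adjoint A * A) *\<^sub>v v = complex_of_real (s\<^sup>2) \<cdot>\<^sub>v v"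
    using A unfolding singular_values_def eigenvalue_def eigenvector_def by auto
  have ev: "mat_adjoint A *\<^sub>v (A *\<^sub>v v) = complex_of_real (s\<^sup>2) \<cdot>\<^sub>v v"
    using ev A v mat_adjoint_carrier[OF A] by (simp add: assoc_mult_mat_vec[of _ n m _ n])
  have "(A *\<^sub>v v) \<bullet>c (A *\<^sub>v v) = complex_of_real (s\<^sup>2) * (v \<bullet>c v)"
    using cscalar_prod_mat_adjoint[OF A v(1), of "A *\<^sub>v v"] A v(1) unfolding ev by simp
  then have "(l2_norm_vec (A *\<^sub>v v))\<^sup>2 = (s * l2_norm_vec v)\<^sup>2"
    unfolding cscalar_prod_self of_real_mult[symmetric] of_real_eq_iff by (simp add: power_mult_distrib)
  then have "l2_norm_vec (A *\<^sub>v v) = s * l2_norm_vec v"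
    using s0 l2_norm_vec_nonneg by (simp add: power2_eq_iff_nonneg)
  with v ev show ?thesis using that by blast
qed

text \<open>Every singular value is the quotient attained at its singular vector and so is at most
  the norm; the eigenvalue result above makes the norm itself a singular value. Membership is kept
  as a conclusion because it provides a maximising vector later.\<close>

lemma l2_op_norm_eq_sigma_max:
  assumes A: "A \<in> carrier_mat n n" and n: "n > 0"
  shows "l2_op_norm A \<in> singular_values A" "l2_op_norm A = sigma_max A"
proof -
  show mem: "l2_op_norm A \<in> singular_values A"
    using l2_op_norm_square_eigenvalue[OF A n] unfolding singular_values_def by simp
  have "s \<le> l2_op_norm A" if "s \<in> singular_values A" for s
  proof -
    obtain v where v: "v \<in> carrier_vec n" "v \<noteq> 0\<^sub>v n" "l2_norm_vec (A *\<^sub>v v) = s * l2_norm_vec v"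
      by (rule singular_vector[OF A \<open>s \<in> singular_values A\<close>])
    then show ?thesis
      using l2_norm_mult_le_op_norm[of v A] A l2_norm_vec_pos[OF v(2,1)] by auto
  qed
  with mem show "l2_op_norm A = sigma_max A"
    unfolding sigma_max_def using finite_singular_values[OF A] by (intro Max_eqI[symmetric]) auto
qed

section \<open>Singular values of the inverse\<close>

text \<open>If \<open>v\<close> is a singular vector of \<open>A\<close>, then
  \<open>w = A v\<close> is one of \<open>B\<close>: applying the inverse \<open>B\<^sup>*\<close>
  of \<open>A\<^sup>*\<close> to \<open>A\<^sup>* w = s\<^sup>2 v\<close> gives
  \<open>B\<^sup>* B w = B\<^sup>* v = w / s\<^sup>2\<close>. Positivity holds because
  \<open>A\<close> is injective, so \<open>w\<close> is nonzero.\<close>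

lemma singular_values_inverse:
  assumes A: "A \<in> carrier_mat n n" and B: "B \<in> carrier_mat n n" and AB: "A * B = 1\<^sub>m n"
    and s: "s \<in> singular_values A"
  shows "s > 0" "1 / s \<in> singular_values B"
proof -
  note A' = mat_adjoint_carrier[OF A] and B' = mat_adjoint_carrier[OF B]
  have BA: "B * A = 1\<^sub>m n" by (rule mat_mult_left_right_inverse[OF A B AB])
  obtain v where v: "v \<in> carrier_vec n" "v \<noteq> 0\<^sub>v n"
    and ev: "mat_adjoint A *\<^sub>v (A *\<^sub>v v) = complex_of_real (s\<^sup>2) \<cdot>\<^sub>v v"
    and nrm: "l2_norm_vec (A *\<^sub>v v) = s * l2_norm_vec v"
    using singular_vector[OF A s] by metis
  define w where "w = A *\<^sub>v v"
  have w: "w \<in> carrier_vec n" using A v unfolding w_def by simp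
  have Bw: "B *\<^sub>v w = v"
    using A B v BA unfolding w_def by (simp flip: assoc_mult_mat_vec)
  have w0: "w \<noteq> 0\<^sub>v n"
  proof
    assume "w = 0\<^sub>v n"
    with Bw B have "v = 0\<^sub>v n" by (auto intro!: eq_vecI)
    with v show False by simp
  qed
  have "0 < s * l2_norm_vec v"
    using l2_norm_vec_pos[OF w0 w] nrm unfolding w_def by simp
  then show s0: "s > 0"
    using l2_norm_vec_nonneg[of v] by (simp add: zero_less_mult_iff)
  have "mat_adjoint B * mat_adjoint A = 1\<^sub>m n"
    using mat_adjoint_mult[OF A B] unfolding AB mat_adjoint_one by simp
  then have "w = mat_adjoint B *\<^sub>v (mat_adjoint A *\<^sub>v w)"
    using A' B' w by (simp flip: assoc_mult_mat_vec)
  also have "\<dots> = complex_of_real (s\<^sup>2) \<cdot>\<^sub>v (mat_adjoint B *\<^sub>v v)"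
    using ev v B' unfolding w_def by (simp add: mult_mat_vec[of _ n n])
  finally have "mat_adjoint B *\<^sub>v v = complex_of_real ((1 / s)\<^sup>2) \<cdot>\<^sub>v w"
    using s0 by (simp add: smult_smult_assoc power_divide)
  then have "(mat_adjoint B * B) *\<^sub>v w = complex_of_real ((1 / s)\<^sup>2) \<cdot>\<^sub>v w"
    using Bw B B' w by (simp add: assoc_mult_mat_vec[of _ n n _ n])
  then show "1 / s \<in> singular_values B"
    using s0 w w0 B unfolding singular_values_def eigenvalue_def eigenvector_def by auto
qed

text \<open>Taking reciprocals maps the singular values of each matrix into those of its inverse and
  reverses their order.\<close>

lemma sigma_max_eq_inverse_sigma_min:
  assumes A: "A \<in> carrier_mat n n" and B: "B \<in> carrier_mat n n" and AB: "A * B = 1\<^sub>m n" and n: "n > 0"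
  shows "sigma_max A = 1 / sigma_min B"
proof -
  have BA: "B * A = 1\<^sub>m n" by (rule mat_mult_left_right_inverse[OF A B AB])
  define s where "s = sigma_max A"
  have s: "s \<in> singular_values A"
    using l2_op_norm_eq_sigma_max[OF A n] unfolding s_def by simp
  have "sigma_min B = 1 / s"
    unfolding sigma_min_def
  proof (rule Min_eqI)
    show "finite (singular_values B)" by (rule finite_singular_values[OF B])
    show "1 / s \<in> singular_values B" by (rule singular_values_inverse[OF A B AB s])
    fix r assume "r \<in> singular_values B"
    note r = singular_values_inverse[OF B A BA this]
    then have "1 / r \<le> s"
      unfolding s_def sigma_max_def using finite_singular_values[OF A] by (intro Max_ge)
    then show "1 / s \<le> r"
      using r(1) singular_values_inverse(1)[OF A B AB s] by (simp add: field_simps)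
  qed
  then show ?thesis unfolding s_def by simp
qed

section \<open>Block matrices\<close>

text \<open>The matrix sends \<open>x @ y\<close> to \<open>0 @ C x\<close>, so \<open>y\<close> can
  only enlarge the denominator of the quotient, and a maximising vector of \<open>C\<close> padded
  with zeros attains the bound. Rows are split as \<open>n + m\<close> but columns as
  \<open>m + n\<close>.\<close>

lemma l2_op_norm_lower_left_block:
  assumes C: "C \<in> carrier_mat m m" and m: "m > 0"
  shows "l2_op_norm (four_block_mat (0\<^sub>m n m) (0\<^sub>m n n) C (0\<^sub>m m n)) = sigma_max C"
    (is "l2_op_norm ?R = _")
proof -
  define s where "s = sigma_max C"
  have s: "s \<in> singular_values C" "l2_op_norm C = s"
    using l2_op_norm_eq_sigma_max[OF C m] unfolding s_def by auto
  have s0: "0 \<le> s" using s(1) unfolding singular_values_def by simp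
  have dim: "dim_col ?R = m + n" using C by simp
  have Rv: "l2_norm_vec (?R *\<^sub>v (x @\<^sub>v y)) = l2_norm_vec (C *\<^sub>v x)"
    if x: "x \<in> carrier_vec m" and y: "y \<in> carrier_vec n" for x y
  proof -
    have "?R *\<^sub>v (x @\<^sub>v y) = (0\<^sub>m n m *\<^sub>v x + 0\<^sub>m n n *\<^sub>v y) @\<^sub>v (C *\<^sub>v x + 0\<^sub>m m n *\<^sub>v y)"
      by (rule four_block_mat_mult_vec) (use C x y in auto)
    also have "\<dots> = 0\<^sub>v n @\<^sub>v (C *\<^sub>v x)"
      using C x y by (intro arg_cong2[of _ _ _ _ append_vec] eq_vecI) auto
    finally have "(l2_norm_vec (?R *\<^sub>v (x @\<^sub>v y)))\<^sup>2 = (l2_norm_vec (C *\<^sub>v x))\<^sup>2"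
      using l2_norm_vec_eq_0_iff[of "0\<^sub>v n"] by (simp add: l2_norm_vec_append_square)
    then show ?thesis using l2_norm_vec_nonneg by (simp add: power2_eq_iff_nonneg)
  qed
  obtain v where v: "v \<in> carrier_vec m" "v \<noteq> 0\<^sub>v m" "l2_norm_vec (C *\<^sub>v v) = s * l2_norm_vec v"
    using singular_vector[OF C s(1)] by metis
  let ?v = "v @\<^sub>v 0\<^sub>v n"
  have nv: "l2_norm_vec ?v = l2_norm_vec v"
    using l2_norm_vec_append_square[of v "0\<^sub>v n"] l2_norm_vec_nonneg l2_norm_vec_eq_0_iff[of "0\<^sub>v n"]
    by (simp add: power2_eq_iff_nonneg)
  have "l2_op_norm ?R = s"
  proof (rule l2_op_norm_eqI, unfold dim)
    show vc: "?v \<in> carrier_vec (m + n)" using v by auto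
    show "?v \<noteq> 0\<^sub>v (m + n)"
      using l2_norm_vec_pos[OF v(2,1)] nv l2_norm_vec_eq_0_iff[of ?v] v(1) by auto
    show "l2_norm_vec (?R *\<^sub>v ?v) = s * l2_norm_vec ?v"
      using Rv[of v "0\<^sub>v n"] v nv by simp
    fix w :: "complex vec" assume w: "w \<in> carrier_vec (m + n)"
    define x y where "x = vec_first w m" and "y = vec_last w n"
    have xy: "w = x @\<^sub>v y" "x \<in> carrier_vec m" "y \<in> carrier_vec n"
      using w unfolding x_def y_def by auto
    have "(l2_norm_vec x)\<^sup>2 \<le> (l2_norm_vec w)\<^sup>2"
      unfolding xy(1) l2_norm_vec_append_square by simp
    then have "l2_norm_vec x \<le> l2_norm_vec w"
      using l2_norm_vec_nonneg by (rule power2_le_imp_le)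
    moreover have "l2_norm_vec (?R *\<^sub>v w) \<le> s * l2_norm_vec x"
      using Rv[OF xy(2,3)] l2_norm_mult_le_op_norm[of x C] xy C s(2) by auto
    ultimately show "l2_norm_vec (?R *\<^sub>v w) \<le> s * l2_norm_vec w"
      using mult_left_mono[OF _ s0] order_trans by blast
  qed
  then show ?thesis unfolding s_def .
qed

section \<open>Inverses and block triangular matrices\<close>

text \<open>A one-sided inverse of a square matrix is two-sided, so \<open>mat_inverse\<close>
  returns \<open>Some\<close>, and uniqueness of inverses identifies the result.\<close>

lemma minv_eqI:
  assumes A: "A \<in> carrier_mat n n" and B: "B \<in> carrier_mat n n" and AB: "A * B = 1\<^sub>m n"
  shows "minv A = B"
proof -
  have BA: "B * A = 1\<^sub>m n" by (rule mat_mult_left_right_inverse[OF A B AB])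
  have "A \<in> Units (ring_mat TYPE(complex) n ())"
    using A B AB BA unfolding Units_def ring_mat_def by auto
  then obtain C where C: "mat_inverse A = Some C"
    using mat_inverse(1)[OF A, of "()"] by (cases "mat_inverse A") auto
  note C' = mat_inverse(2)[OF A C]
  have "C = (B * A) * C" using C' left_mult_one_mat[of C n n] unfolding BA by simp
  also have "\<dots> = B * (A * C)" using A B C' by (intro assoc_mult_mat) auto
  finally show ?thesis using C' B C unfolding minv_def by simp
qed

lemma minv_inverse:
  assumes A: "A \<in> carrier_mat n n" and d: "det A \<noteq> 0"
  shows "minv A \<in> carrier_mat n n" "A * minv A = 1\<^sub>m n" "minv A * A = 1\<^sub>m n"
proof -
  from det_non_zero_imp_unit[OF A d, unfolded Units_def ring_mat_def]
  obtain K where K: "K \<in> carrier_mat n n" "A * K = 1\<^sub>m n" "K * A = 1\<^sub>m n" by auto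
  with minv_eqI[OF A K(1,2)]
  show "minv A \<in> carrier_mat n n" "A * minv A = 1\<^sub>m n" "minv A * A = 1\<^sub>m n" by auto
qed

text \<open>Used to check that \<open>D * minv P\<close> and \<open>P * minv D\<close>, and likewise
  \<open>minv Q * D\<close> and \<open>minv D * Q\<close>, are inverse to each other.\<close>

lemma mult_mat_cancel_middle:
  fixes A B C E :: "complex mat"
  assumes A: "A \<in> carrier_mat n n" and B: "B \<in> carrier_mat n n" and C: "C \<in> carrier_mat n n"
    and E: "E \<in> carrier_mat n n" and BC: "B * C = 1\<^sub>m n"
  shows "(A * B) * (C * E) = A * E"
proof -
  have "(A * B) * (C * E) = A * (B * (C * E))"
    using A B C E by (intro assoc_mult_mat) auto
  also have "B * (C * E) = (B * C) * E"
    using B C E by (intro assoc_mult_mat[symmetric])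
  finally show ?thesis using E unfolding BC by simp
qed

text \<open>Block forward substitution: the lower left block \<open>Y\<close> of the inverse is the
  solution of \<open>X * minv P + Q * Y = 0\<close>.\<close>

lemma minv_lower_block_triangular:
  assumes P: "P \<in> carrier_mat a a" and Q: "Q \<in> carrier_mat b b" and X: "X \<in> carrier_mat b a"
    and "det P \<noteq> 0" "det Q \<noteq> 0"
  shows "minv (four_block_mat P (0\<^sub>m a b) X Q)
    = four_block_mat (minv P) (0\<^sub>m a b) (- (minv Q * X * minv P)) (minv Q)"
proof -
  note P' = minv_inverse[OF P \<open>det P \<noteq> 0\<close>] and Q' = minv_inverse[OF Q \<open>det Q \<noteq> 0\<close>]
  let ?Y = "- (minv Q * X * minv P)"
  have Y: "?Y \<in> carrier_mat b a" using P' Q' X by auto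
  have "Q * (minv Q * (X * minv P)) = (Q * minv Q) * (X * minv P)"
    using Q Q' X P' by (intro assoc_mult_mat[symmetric]) auto
  then have "Q * ?Y = - (X * minv P)"
    using Q Q' X P' by simp
  then have QY: "X * minv P + Q * ?Y = 0\<^sub>m b a"
    using X P' by (intro eq_matI) auto
  show ?thesis
  proof (rule minv_eqI)
    show "four_block_mat P (0\<^sub>m a b) X Q \<in> carrier_mat (a + b) (a + b)"
      "four_block_mat (minv P) (0\<^sub>m a b) ?Y (minv Q) \<in> carrier_mat (a + b) (a + b)"
      using P Q P' Q' by auto
    show "four_block_mat P (0\<^sub>m a b) X Q * four_block_mat (minv P) (0\<^sub>m a b) ?Y (minv Q) = 1\<^sub>m (a + b)"
      using P Q X P' Q' Y QY
      by (subst mult_four_block_mat[of _ a a _ b _ b _ _ a _ b]) (auto intro!: eq_matI)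
  qed
qed

section \<open>Principal submatrices as diagonal blocks\<close>

text \<open>\<open>submatrix\<close> enumerates its index set by \<open>pick\<close>. Exactly
  \<open>i\<close> elements of the interval lie below \<open>a + i\<close>, so here
  \<open>pick\<close> is the shift by \<open>a\<close>.\<close>

lemma submatrix_interval:
  assumes A: "A \<in> carrier_mat m m" and le: "a + b \<le> m"
  shows "submatrix A {a..<a + b} {a..<a + b} = mat b b (\<lambda>(r, c). A $$ (a + r, a + c))"
proof -
  have pick: "pick {a..<a + b} i = a + i" if "i < b" for i
  proof -
    have "{x \<in> {a..<a + b}. x < a + i} = {a..<a + i}" using that by auto
    then show ?thesis using pick_card_in_set[of "a + i" "{a..<a + b}"] that by simp
  qed
  have "{i. i < m \<and> i \<in> {a..<a + b}} = {a..<a + b}" using le by auto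
  then show ?thesis
    using A pick unfolding submatrix_def by (intro eq_matI) auto
qed

text \<open>Links the submatrices in the definitions of \<open>B_tilde\<close> and
  \<open>B_hat\<close> to the block form that \<open>minv_lower_block_triangular\<close>
  expects.\<close>

lemma lower_block_triangular_submatrix:
  fixes A :: "complex mat"
  assumes A: "A \<in> carrier_mat (a + b) (a + b)"
    and z: "\<And>r c. r < a \<Longrightarrow> a \<le> c \<Longrightarrow> c < a + b \<Longrightarrow> A $$ (r, c) = 0"
  shows "A = four_block_mat (submatrix A {0..<a} {0..<a}) (0\<^sub>m a b)
    (mat b a (\<lambda>(r, c). A $$ (a + r, c))) (submatrix A {a..<a + b} {a..<a + b})"
  using A z submatrix_interval[OF A, of 0 a] submatrix_interval[OF A, of a b]
  by (intro eq_matI) auto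

section \<open>Block bidiagonal and block diagonal matrices\<close>

lemma block_mat_carrier: "block_mat N n F \<in> carrier_mat (N * n) (N * n)"
  unfolding block_mat_def by simp

lemma block_mat_index:
  "r < N * n \<Longrightarrow> c < N * n \<Longrightarrow>
    block_mat N n F $$ (r, c) = F (r div n) (c div n) $$ (r mod n, c mod n)"
  unfolding block_mat_def by simp

text \<open>On and above the diagonal the block row never exceeds the block column, so only identity
  and zero blocks are met.\<close>

lemma block_lower_bidiag_upper_triangle:
  assumes r: "r \<le> c" and c: "c < N * n"
  shows "block_lower_bidiag N n L $$ (r, c) = (if r = c then 1 else 0)"
proof -
  have n: "n > 0" using c by (cases n) auto
  have le: "r div n \<le> c div n" using r by (rule div_le_mono)
  show ?thesis
  proof (cases "r div n = c div n")
    case True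
    moreover have "r = c" if "r mod n = c mod n"
      using True that by (metis div_mult_mod_eq)
    ultimately show ?thesis
      using r c n unfolding block_lower_bidiag_def by (auto simp: block_mat_index)
  next
    case False
    then show ?thesis
      using le r c n unfolding block_lower_bidiag_def by (auto simp: block_mat_index)
  qed
qed

text \<open>The matrix is unit lower triangular. This gives invertibility of \<open>B_Delta\<close>
  and, through block determinants, of its diagonal blocks.\<close>

lemma det_block_lower_bidiag: "det (block_lower_bidiag N n L) = 1"
proof -
  let ?B = "block_lower_bidiag N n L"
  have B: "?B \<in> carrier_mat (N * n) (N * n)"
    unfolding block_lower_bidiag_def by (rule block_mat_carrier)
  have "diag_mat ?B = map (\<lambda>i. 1) [0..<N * n]"
    using B unfolding diag_mat_def by (auto simp: block_lower_bidiag_upper_triangle)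
  moreover have "det ?B = prod_list (diag_mat ?B)"
    by (rule det_lower_triangular[OF _ B]) (simp add: block_lower_bidiag_upper_triangle)
  ultimately show ?thesis by (simp add: map_replicate_const prod_list_replicate)
qed

text \<open>Turns the recursive \<open>diag_block_mat\<close> into an entrywise formula: splitting
  off the first block lowers both block indices by one.\<close>

lemma diag_block_mat_equal_sized:
  fixes Ds :: "complex mat list"
  assumes "\<And>D. D \<in> set Ds \<Longrightarrow> D \<in> carrier_mat n n" and n: "n > 0"
  shows "diag_block_mat Ds = block_mat (length Ds) n (\<lambda>i j. if i = j then Ds ! i else 0\<^sub>m n n)"
  using assms(1)
proof (induction Ds)
  case Nil
  show ?case by (intro eq_matI) (auto simp: block_mat_def)
next
  case (Cons D Ds)
  let ?B = "block_mat (length Ds) n (\<lambda>i j. if i = j then Ds ! i else 0\<^sub>m n n)"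
  have D: "D \<in> carrier_mat n n" using Cons.prems by simp
  have IH: "diag_block_mat Ds = ?B" using Cons by simp
  note B = block_mat_carrier[of "length Ds" n "\<lambda>i j. if i = j then Ds ! i else 0\<^sub>m n n"]
  have "four_block_mat D (0\<^sub>m n (length Ds * n)) (0\<^sub>m (length Ds * n) n) ?B
    = block_mat (length (D # Ds)) n (\<lambda>i j. if i = j then (D # Ds) ! i else 0\<^sub>m n n)" (is "?L = ?R")
  proof (rule eq_matI)
    fix r c assume "r < dim_row ?R" "c < dim_col ?R"
    then have rc: "r < length (D # Ds) * n" "c < length (D # Ds) * n"
      by (auto simp: block_mat_def)
    have div: "x div n = Suc ((x - n) div n)" "x mod n = (x - n) mod n" if "\<not> x < n" for x
      using that n by (simp_all add: le_div_geq le_mod_geq)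
    show "?L $$ (r, c) = ?R $$ (r, c)"
      using rc D B by (cases "r < n"; cases "c < n")
        (auto simp: block_mat_index div less_diff_conv2)
  qed (use D B in \<open>auto simp: block_mat_def\<close>)
  then show ?case using IH D B by (simp add: Let_def)
qed

lemma det_diag_block_mat_nonzero:
  fixes Ds :: "complex mat list"
  assumes "\<And>D. D \<in> set Ds \<Longrightarrow> D \<in> carrier_mat n n \<and> det D \<noteq> 0"
  shows "det (diag_block_mat Ds) \<noteq> 0"
  using assms
proof (induction Ds)
  case (Cons D Ds)
  have "square_mat (diag_block_mat Ds)"
    by (rule diag_block_mat_square) (use Cons.prems in auto)
  then obtain e where E: "diag_block_mat Ds \<in> carrier_mat e e" by auto
  have D: "D \<in> carrier_mat n n" "det D \<noteq> 0" using Cons.prems by auto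
  have "det (diag_block_mat (D # Ds)) = det D * det (diag_block_mat Ds)"
    unfolding diag_block_mat.simps Let_def
    by (rule det_four_block_mat_upper_right_zero[OF D(1) _ _ E]) (use D E in auto)
  then show ?case using Cons D by (simp del: diag_block_mat.simps)
qed simp

text \<open>The identity blocks cancel and only the subdiagonal survives, with blocks
  \<open>- L' i - (- L i)\<close>. Cutting off the first block row and the last block column turns
  this subdiagonal into a diagonal. It is applied with the fine propagators as \<open>L\<close> and
  \<open>\<Psi>\<close> as \<open>L'\<close>.\<close>

lemma block_lower_bidiag_diff:
  assumes L: "\<And>i. i \<in> {1..m} \<Longrightarrow> L i \<in> carrier_mat n n"
    and L': "\<And>i. i \<in> {1..m} \<Longrightarrow> L' i \<in> carrier_mat n n"
    and n: "n > 0"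
  shows "block_lower_bidiag (Suc m) n L' - block_lower_bidiag (Suc m) n L
    = four_block_mat (0\<^sub>m n (m * n)) (0\<^sub>m n n)
        (diag_block_mat (map (\<lambda>i. L i - L' i) [1..<Suc m])) (0\<^sub>m (m * n) n)" (is "?lhs = ?rhs")
proof (rule eq_matI)
  let ?Ds = "map (\<lambda>i. L i - L' i) [1..<Suc m]"
  have "diag_block_mat ?Ds = block_mat (length ?Ds) n (\<lambda>i j. if i = j then ?Ds ! i else 0\<^sub>m n n)"
    by (rule diag_block_mat_equal_sized) (use L L' n in \<open>auto simp del: upt_Suc intro!: minus_carrier_mat\<close>)
  then have D: "diag_block_mat ?Ds = block_mat m n (\<lambda>i j. if i = j then ?Ds ! i else 0\<^sub>m n n)"
    by (simp del: upt_Suc)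
  note Dc = block_mat_carrier[of m n "\<lambda>i j. if i = j then ?Ds ! i else 0\<^sub>m n n", folded D]
  show "dim_row ?lhs = dim_row ?rhs" "dim_col ?lhs = dim_col ?rhs"
    using Dc by (auto simp: block_lower_bidiag_def block_mat_def)
  fix r c assume "r < dim_row ?rhs" "c < dim_col ?rhs"
  then have rc: "r < Suc m * n" "c < Suc m * n" using Dc by auto
  have dr: "r div n \<le> m" and dc: "c div n \<le> m"
    using rc n by (simp_all add: less_mult_imp_div_less less_Suc_eq_le[symmetric])
  have lhs: "?lhs $$ (r, c) = (if r div n = Suc (c div n)
      then (L (r div n) - L' (r div n)) $$ (r mod n, c mod n) else 0)"
    using rc n dr L L' unfolding block_lower_bidiag_def
    by (auto simp: block_mat_index block_mat_carrier[THEN carrier_matD(1)]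
        block_mat_carrier[THEN carrier_matD(2)] carrier_matD[OF L] carrier_matD[OF L'])
  show "?lhs $$ (r, c) = ?rhs $$ (r, c)"
  proof (cases "r < n")
    case True
    then show ?thesis using rc Dc unfolding lhs by auto
  next
    case rn: False
    then have r: "r div n = Suc ((r - n) div n)" "r mod n = (r - n) mod n"
      using n by (simp_all add: le_div_geq le_mod_geq)
    show ?thesis
    proof (cases "c < m * n")
      case True
      then have "?rhs $$ (r, c) = diag_block_mat ?Ds $$ (r - n, c)"
        using rn rc Dc by auto
      \<comment> \<open>Lists count from 0 and time steps from 1: \<open>?Ds ! i\<close> is the
        difference for step \<open>Suc i\<close>, which sits in block row \<open>Suc i\<close> of
        the full matrix.\<close>
      also have "\<dots> = (if r div n = Suc (c div n)
          then (L (r div n) - L' (r div n)) $$ (r mod n, c mod n) else 0)"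
        using rn rc True dr n unfolding D by (auto simp: block_mat_index r simp del: upt_Suc)
      finally show ?thesis unfolding lhs by simp
    next
      case False
      \<comment> \<open>In the last block column a subdiagonal block would need block row
        \<open>Suc m\<close>, which is out of range.\<close>
      then have "m \<le> c div n" using n by (simp add: less_eq_div_iff_mult_less_eq)
      with dr have "?lhs $$ (r, c) = 0" unfolding lhs by simp
      moreover have "?rhs $$ (r, c) = 0" using rn rc Dc False by auto
      ultimately show ?thesis by simp
    qed
  qed
qed

lemma step_prod_carrier:
  assumes "\<And>l. l \<in> {j..i} \<Longrightarrow> \<Phi> l \<in> carrier_mat n n"
  shows "step_prod n \<Phi> i j \<in> carrier_mat n n"
proof -
  have foldr: "foldr (\<lambda>l P. \<Phi> l * P) ls (1\<^sub>m n) \<in> carrier_mat n n" if "set ls \<subseteq> {j..i}" for ls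
    using that by (induction ls) (auto intro!: mult_carrier_mat[of _ n n] assms)
  show ?thesis unfolding step_prod_def by (rule foldr) auto
qed

lemma invertible_mat_det_nonzero:
  fixes A :: "complex mat"
  assumes A: "A \<in> carrier_mat n n" and "invertible_mat A"
  shows "det A \<noteq> 0"
proof -
  \<comment> \<open>\<open>inverts_mat\<close> leaves the shape of \<open>B\<close> open; comparing
    column counts in the two products forces it to be \<open>n\<close> by \<open>n\<close>.\<close>
  obtain B where B: "A * B = 1\<^sub>m n" "B * A = 1\<^sub>m (dim_row B)"
    using assms unfolding invertible_mat_def inverts_mat_def by auto
  have "dim_col B = dim_col (A * B)" by simp
  then have "dim_col B = n" unfolding B by simp
  moreover have "dim_row B = n" using arg_cong[OF B(2), of dim_col] A by simp
  ultimately have "B \<in> carrier_mat n n" by auto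
  from det_mult[OF A this] show ?thesis unfolding B by auto
qed

section \<open>Norms of the residual and error propagators\<close>

theorem mainTheorem1:
  fixes N n k :: nat and \<Phi> \<Psi> :: "nat \<Rightarrow> complex mat"
  assumes "N \<ge> 2" and "k \<ge> 1" and "n \<ge> 1"
    and "\<And>i. i \<in> {1..(N - 1) * k} \<Longrightarrow> \<Phi> i \<in> carrier_mat n n"
    and "\<And>i. i \<in> {1..N - 1} \<Longrightarrow> \<Psi> i \<in> carrier_mat n n"
    and "\<And>i. i \<in> {1..N - 1} \<Longrightarrow>
           invertible_mat (step_prod n \<Phi> (i * k) ((i - 1) * k + 1) - \<Psi> i)"
  shows "l2_op_norm (R_F N n k \<Phi> \<Psi>)
           = sigma_max (D_tilde N n k \<Phi> \<Psi> * minv (B_tilde N n \<Psi>))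
       \<and> sigma_max (D_tilde N n k \<Phi> \<Psi> * minv (B_tilde N n \<Psi>))
           = 1 / sigma_min (B_tilde N n \<Psi> * minv (D_tilde N n k \<Phi> \<Psi>))
       \<and> l2_op_norm (E_F N n k \<Phi> \<Psi>)
           = sigma_max (minv (B_hat N n \<Psi>) * D_tilde N n k \<Phi> \<Psi>)
       \<and> sigma_max (minv (B_hat N n \<Psi>) * D_tilde N n k \<Phi> \<Psi>)
           = 1 / sigma_min (minv (D_tilde N n k \<Phi> \<Psi>) * B_hat N n \<Psi>)"
proof -
  \<comment> \<open>\<open>m\<close> is the number of diagonal blocks of \<open>D_tilde\<close>; its
    positivity keeps the sets of singular values nonempty.\<close>
  obtain m where N: "N = Suc m" and m: "m > 0"
    using \<open>N \<ge> 2\<close> by (cases N) auto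
  have n: "n > 0" using \<open>n \<ge> 1\<close> by simp
  have mn: "m * n > 0" using m n by simp
  define L where "L i = step_prod n \<Phi> (i * k) ((i - 1) * k + 1)" for i
  define A where "A = A_Delta N n k \<Phi>"
  define B where "B = B_Delta N n \<Psi>"
  define D where "D = D_tilde N n k \<Phi> \<Psi>"
  define P where "P = B_tilde N n \<Psi>"
  define Q where "Q = B_hat N n \<Psi>"
  have \<Psi>: "\<Psi> i \<in> carrier_mat n n" if "i \<in> {1..m}" for i
    using assms(5) that N by simp
  have L: "L i \<in> carrier_mat n n" if i: "i \<in> {1..m}" for i
    unfolding L_def
  proof (rule step_prod_carrier)
    fix l assume "l \<in> {(i - 1) * k + 1..i * k}"
    moreover have "i * k \<le> m * k" using i by simp
    ultimately show "\<Phi> l \<in> carrier_mat n n"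
      using N by (intro assms(4)) (auto intro: order_trans)
  qed
  let ?Ds = "map (\<lambda>i. L i - \<Psi> i) [1..<Suc m]"
  have D_eq: "D = diag_block_mat ?Ds" unfolding D_def D_tilde_def L_def N by simp
  have "det (L i - \<Psi> i) \<noteq> 0" if "i \<in> {1..m}" for i
    by (rule invertible_mat_det_nonzero[of _ n]) (use L \<Psi> that assms(6)[of i] N in \<open>auto simp: L_def minus_carrier_mat\<close>)
  then have detD: "det D \<noteq> 0"
    unfolding D_eq by (intro det_diag_block_mat_nonzero[of _ n])
      (use L \<Psi> in \<open>auto simp: minus_carrier_mat simp del: upt_Suc\<close>)
  have D: "D \<in> carrier_mat (m * n) (m * n)"
  proof -
    have "D = block_mat (length ?Ds) n (\<lambda>i j. if i = j then ?Ds ! i else 0\<^sub>m n n)"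
      unfolding D_eq by (rule diag_block_mat_equal_sized)
        (use L \<Psi> n in \<open>auto simp: minus_carrier_mat simp del: upt_Suc\<close>)
    then show ?thesis using block_mat_carrier by (simp del: upt_Suc)
  qed
  \<comment> \<open>Two ways to cut \<open>B\<close>: before its last block for
    \<open>B_tilde\<close>, and after its first block for \<open>B_hat\<close>.\<close>
  have Nn: "N * n = m * n + n" "N * n = n + m * n" unfolding N by simp_all
  have A: "A \<in> carrier_mat (N * n) (N * n)" and B: "B \<in> carrier_mat (N * n) (N * n)"
    unfolding A_def A_Delta_def B_def B_Delta_def block_lower_bidiag_def by (rule block_mat_carrier)+
  have detB: "det B = 1" unfolding B_def B_Delta_def by (rule det_block_lower_bidiag)
  note B' = minv_inverse[OF B, unfolded detB, OF one_neq_zero]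
  have BA: "B - A = four_block_mat (0\<^sub>m n (m * n)) (0\<^sub>m n n) D (0\<^sub>m (m * n) n)"
    using block_lower_bidiag_diff[OF L \<Psi> n]
    unfolding A_def A_Delta_def B_def B_Delta_def D_eq L_def N by simp
  have upper: "B $$ (r, c) = 0" if "r < c" "c < N * n" for r c
    using that block_lower_bidiag_upper_triangle[of r c N n \<Psi>] unfolding B_def B_Delta_def by simp

  \<comment> \<open>This cut matches the column split \<open>m * n + n\<close> of
    \<open>B - A\<close>, as the product \<open>(B - A) * minv B\<close> requires.\<close>
  obtain X Y where BP: "B = four_block_mat P (0\<^sub>m (m * n) n) X Y"
    and P: "P \<in> carrier_mat (m * n) (m * n)" and X: "X \<in> carrier_mat n (m * n)" and Y: "Y \<in> carrier_mat n n"
  proof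
    show "B = four_block_mat P (0\<^sub>m (m * n) n)
        (mat n (m * n) (\<lambda>(r, c). B $$ (m * n + r, c))) (submatrix B {m * n..<m * n + n} {m * n..<m * n + n})"
      using lower_block_triangular_submatrix[of B "m * n" n] B upper
      unfolding Nn(1) P_def B_tilde_def B_def[symmetric] by (simp add: N)
    show "P \<in> carrier_mat (m * n) (m * n)"
      using submatrix_interval[OF B, of 0 "m * n"] unfolding P_def B_tilde_def B_def[symmetric] by (simp add: N)
    show "submatrix B {m * n..<m * n + n} {m * n..<m * n + n} \<in> carrier_mat n n"
      using submatrix_interval[OF B, of "m * n" n] by (simp add: N)
  qed auto
  \<comment> \<open>The determinant of a block triangular matrix factors, so
    \<open>det B = 1\<close> makes both diagonal blocks invertible.\<close>
  have "det P * det Y = 1"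
    using detB det_four_block_mat_upper_right_zero[OF P refl X Y] unfolding BP by simp
  then have detP: "det P \<noteq> 0" and detY: "det Y \<noteq> 0" by auto
  note P' = minv_inverse[OF P detP] and Y' = minv_inverse[OF Y detY] and D' = minv_inverse[OF D detD]
  \<comment> \<open>Writing the identity as \<open>B * minv B\<close> brings out the factor
    \<open>B - A\<close>, whose only nonzero block is \<open>D\<close>.\<close>
  have "R_F N n k \<Phi> \<Psi> = B * minv B - A * minv B"
    using B' unfolding R_F_def A_def B_def by simp
  also have "\<dots> = (B - A) * minv B"
    using A B B' by (intro minus_mult_distrib_mat[symmetric]) auto
  \<comment> \<open>\<open>D\<close> meets only the first block row of \<open>minv B\<close>, which
    is \<open>minv P\<close> followed by zeros.\<close>
  also have "\<dots> = four_block_mat (0\<^sub>m n (m * n)) (0\<^sub>m n n) (D * minv P) (0\<^sub>m (m * n) n)"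
    unfolding BA unfolding BP minv_lower_block_triangular[OF P Y X detP detY]
    using D P' Y' X
    by (subst mult_four_block_mat[of _ n "m * n" _ n _ "m * n" _ _ "m * n" _ n]) auto
  finally have R: "l2_op_norm (R_F N n k \<Phi> \<Psi>) = sigma_max (D * minv P)"
    using l2_op_norm_lower_left_block[of "D * minv P" "m * n" n] D P' mn by simp
  have DP: "sigma_max (D * minv P) = 1 / sigma_min (P * minv D)"
  proof (rule sigma_max_eq_inverse_sigma_min[OF _ _ _ mn])
    show "D * minv P * (P * minv D) = 1\<^sub>m (m * n)"
      using mult_mat_cancel_middle[OF D P'(1) P D'(1) P'(3)] D' by simp
  qed (use D P P' D' in auto)

  \<comment> \<open>With \<open>B - A\<close> on the right, its row split \<open>n + m * n\<close>
    decides the cut, and the trailing block becomes \<open>Q\<close>.\<close>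
  obtain X Y where BQ: "B = four_block_mat Y (0\<^sub>m n (m * n)) X Q"
    and Q: "Q \<in> carrier_mat (m * n) (m * n)" and X: "X \<in> carrier_mat (m * n) n" and Y: "Y \<in> carrier_mat n n"
  proof
    show "B = four_block_mat (submatrix B {0..<n} {0..<n}) (0\<^sub>m n (m * n))
        (mat (m * n) n (\<lambda>(r, c). B $$ (n + r, c))) Q"
      using lower_block_triangular_submatrix[of B n "m * n"] B upper
      unfolding Nn(2) Q_def B_hat_def B_def[symmetric] by simp
    show "Q \<in> carrier_mat (m * n) (m * n)"
      using submatrix_interval[OF B, of n "m * n"] unfolding Q_def B_hat_def B_def[symmetric] by (simp add: N)
    show "submatrix B {0..<n} {0..<n} \<in> carrier_mat n n"
      using submatrix_interval[OF B, of 0 n] by (simp add: N)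
  qed auto
  have "det Y * det Q = 1"
    using detB det_four_block_mat_upper_right_zero[OF Y refl X Q] unfolding BQ by simp
  then have detQ: "det Q \<noteq> 0" and detY: "det Y \<noteq> 0" by auto
  note Q' = minv_inverse[OF Q detQ] and Y' = minv_inverse[OF Y detY]
  have "E_F N n k \<Phi> \<Psi> = minv B * B - minv B * A"
    using B' unfolding E_F_def A_def B_def by simp
  also have "\<dots> = minv B * (B - A)"
    using A B B' by (intro mult_minus_distrib_mat[symmetric]) auto
  \<comment> \<open>\<open>D\<close> now meets only the last block column of \<open>minv B\<close>,
    which is zero above \<open>minv Q\<close>.\<close>
  also have "\<dots> = four_block_mat (0\<^sub>m n (m * n)) (0\<^sub>m n n) (minv Q * D) (0\<^sub>m (m * n) n)"
    unfolding BA unfolding BQ minv_lower_block_triangular[OF Y Q X detY detQ]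
    using D Q' Y' X
    by (subst mult_four_block_mat[of _ n n _ "m * n" _ "m * n" _ _ "m * n" _ n]) auto
  finally have E: "l2_op_norm (E_F N n k \<Phi> \<Psi>) = sigma_max (minv Q * D)"
    using l2_op_norm_lower_left_block[of "minv Q * D" "m * n" n] D Q' mn by simp
  have QD: "sigma_max (minv Q * D) = 1 / sigma_min (minv D * Q)"
  proof (rule sigma_max_eq_inverse_sigma_min[OF _ _ _ mn])
    show "minv Q * D * (minv D * Q) = 1\<^sub>m (m * n)"
      using mult_mat_cancel_middle[OF Q'(1) D D'(1) Q D'(2)] Q' by simp
  qed (use D Q Q' D' in auto)
  show ?thesis
    using R DP E QD unfolding D_def P_def Q_def by simp
qed

end
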